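(* Fix $h\in\mathbb C^\times$, let $U\subseteq\mathbb C$ be half-step-invariant, and let $X:U\to\mathbb C$, $X(s)=e^{\pi is/h}$, be admissible on $U$. Let $D,S:\mathcal P\to\mathcal P$ be the associated divided-difference and averaging operators, with transposes $\mathbf D,\mathbf S:\mathcal P'\to\mathcal P'$. Let $\mathbf u\in\mathcal P'$ be such that $\langle\mathbf u,1\rangle\neq0$. Then the following are equivalent: (i) There exist polynomials $\phi$ and $\psi$, with $\deg\phi\le2$ and $\deg\psi=1$, such that $\mathbf D(\phi\,\mathbf u)=\mathbf S(\psi\,\mathbf u)$ in $\mathcal P'$. (ii) There exists $\tau\in\mathbb C$ such that $\langle\mathbf u,(x-\tau)r(x^2)\rangle=0$ for every $r\in\mathcal P$. (iii) There exist $\tau\in\mathbb C$ and $\mathbf v\in\mathcal P'$ such that $\mathbf u=\mathbf J_\tau\mathbf v$. In that case $\tau$ and $\mathbf v$ are uniquely determined by $\mathbf u$, and $$\tau=\frac{\langle\mathbf u,x\rangle}{\langle\mathbf u,1\rangle},\qquad \mathbf v=\boldsymbol\sigma\mathbf u.$$ Assume henceforth that these equivalent conditions hold. Let either $I=J_I=K_I=\mathbb N$ (infinite case), or, for some $N\in\mathbb N$, $I=\{0,1,\dots,2N+2\}$, $J_I=\{0,1,\dots,N+1\}$, $K_I=\{0,1,\dots,N\}$ (finite case). Then the following are equivalent: (iv) There exists a monic orthogonal polynomial sequence $(R_n)_{n\in J_I}$ with respect to $\mathbf v$ such that $R_n(\tau^2)\neq0$ for every $n\in J_I$. (v) There exists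 a monic orthogonal polynomial sequence $(P_n)_{n\in I}$ with respect to $\mathbf u$. Whenever these conditions hold, the functional $(x-\tau^2)\mathbf v$ admits a monic orthogonal polynomial sequence $(S_n)_{n\in K_I}$, where, for every $n\in K_I$, $$S_n(x)=\frac{R_{n+1}(x)-\dfrac{R_{n+1}(\tau^2)}{R_n(\tau^2)}R_n(x)}{x-\tau^2}.$$ Moreover, the monic orthogonal polynomial sequence with respect to $\mathbf u$ is given, for every $n\in K_I$, by $$P_{2n}(x)=R_n(x^2),\qquad P_{2n+1}(x)=(x-\tau)S_n(x^2),$$ together with $P_{2N+2}(x)=R_{N+1}(x^2)$ in the finite case.
   Context: $\mathbb N=\{0,1,2,\dots\}$, $\mathbb C^\times=\mathbb C\setminus\{0\}$. Fix $h\in\mathbb C^\times$. A non-empty set $U\subseteq\mathbb C$ is half-step-invariant if $U\pm\frac h2\subseteq U$. For $X:U\to\mathbb C$ put $Y(s)=X(s+\frac h2)$, $Z(s)=X(s-\frac h2)$. $X$ is parametrising if $Y-Z$ vanishes nowhere on $U$; it is admissible if moreover $X(U)$ is infinite and for every complex polynomial $p$ of degree $\ge1$ there is a polynomial $Q$ with $\deg Q\le\deg p-1$ and $\frac{p(Y)-p(Z)}{Y-Z}=Q(X)$ throughout $U$. $\mathcal P$ is the space of complex polynomials, the inductive limit of the finite-dimensional spaces $\mathcal P_n$ of polynomials of degree at most $n$; its continuous dual $\mathcal P'$ coincides with the space of all linear functionals on $\mathcal P$. For admissible $X$, $Dp$ and $Sp$ are the unique polynomials with $(Dp)(X)=\frac{p(Y)-p(Z)}{Y-Z}$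 and $(Sp)(X)=\frac{p(Y)+p(Z)}2$ throughout $U$. On $\mathcal P'$: $\langle p_0\mathbf u,p\rangle=\langle\mathbf u,p_0p\rangle$, $\langle\mathbf D\mathbf u,p\rangle=-\langle\mathbf u,Dp\rangle$, $\langle\mathbf S\mathbf u,p\rangle=\langle\mathbf u,Sp\rangle$. $\boldsymbol\sigma:\mathcal P'\to\mathcal P'$ is defined by $\langle\boldsymbol\sigma\mathbf u,p\rangle=\langle\mathbf u,p(x^2)\rangle$. For $\tau\in\mathbb C$, every $p\in\mathcal P$ is uniquely $p(x)=a(x^2)+(x-\tau)b(x^2)$ with $a,b\in\mathcal P$; $J_\tau p=a$, and $\mathbf J_\tau:\mathcal P'\to\mathcal P'$ is defined by $\langle\mathbf J_\tau\mathbf v,p\rangle=\langle\mathbf v,J_\tau p\rangle$. A family $(P_n)_{n\in I}$ with $\deg P_n=n$ is orthogonal with respect to $\mathbf u$ if $\langle\mathbf u,P_nP_m\rangle=0$ for $m,n\in I$, $m<n$, and $\langle\mathbf u,P_n^2\rangle\neq0$ for $n\in I$. *)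

theory Defs
  imports Complex_Main "HOL-Computational_Algebra.Polynomial"
begin

definition half_step_invariant :: "complex \<Rightarrow> complex set \<Rightarrow> bool" where
  "half_step_invariant h U \<longleftrightarrow>
     U \<noteq> {} \<and> (\<forall>s\<in>U. s + h / 2 \<in> U \<and> s - h / 2 \<in> U)"

text \<open>A map from \<open>U\<close> to the complex numbers is represented by a total function of which only the
  values on \<open>U\<close> matter; on a half-step-invariant \<open>U\<close> the shifts below stay in \<open>U\<close>.\<close>

definition shift_Y :: "complex \<Rightarrow> (complex \<Rightarrow> complex) \<Rightarrow> complex \<Rightarrow> complex" where
  "shift_Y h X s = X (s + h / 2)"

definition shift_Z :: "complex \<Rightarrow> (complex \<Rightarrow> complex) \<Rightarrow> complex \<Rightarrow> complex" where
  "shift_Z h X s = X (s - h / 2)"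

definition parametrising :: "complex \<Rightarrow> complex set \<Rightarrow> (complex \<Rightarrow> complex) \<Rightarrow> bool" where
  "parametrising h U X \<longleftrightarrow> (\<forall>s\<in>U. shift_Y h X s - shift_Z h X s \<noteq> 0)"

definition divided_diff ::
  "complex \<Rightarrow> (complex \<Rightarrow> complex) \<Rightarrow> complex poly \<Rightarrow> complex \<Rightarrow> complex" where
  "divided_diff h X p s =
     (poly p (shift_Y h X s) - poly p (shift_Z h X s)) / (shift_Y h X s - shift_Z h X s)"

definition average ::
  "complex \<Rightarrow> (complex \<Rightarrow> complex) \<Rightarrow> complex poly \<Rightarrow> complex \<Rightarrow> complex" where
  "average h X p s = (poly p (shift_Y h X s) + poly p (shift_Z h X s)) / 2"

definition admissible :: "complex \<Rightarrow> complex set \<Rightarrow> (complex \<Rightarrow> complex) \<Rightarrow> bool" where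
  "admissible h U X \<longleftrightarrow>
     parametrising h U X \<and> infinite (X ` U) \<and>
     (\<forall>p :: complex poly. degree p \<ge> 1 \<longrightarrow>
        (\<exists>Q. degree Q \<le> degree p - 1 \<and> (\<forall>s\<in>U. divided_diff h X p s = poly Q (X s))))"

text \<open>For admissible \<open>X\<close> the polynomials selected here exist and are unique.\<close>

definition op_D ::
  "complex \<Rightarrow> complex set \<Rightarrow> (complex \<Rightarrow> complex) \<Rightarrow> complex poly \<Rightarrow> complex poly" where
  "op_D h U X p = (THE q. \<forall>s\<in>U. poly q (X s) = divided_diff h X p s)"

definition op_S ::
  "complex \<Rightarrow> complex set \<Rightarrow> (complex \<Rightarrow> complex) \<Rightarrow> complex poly \<Rightarrow> complex poly" where
  "op_S h U X p = (THE q. \<forall>s\<in>U. poly q (X s) = average h X p s)"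

text \<open>The continuous dual of the space of polynomials, with its inductive limit topology, is the
  space of all linear functionals.\<close>

definition functional :: "(complex poly \<Rightarrow> complex) \<Rightarrow> bool" where
  "functional u \<longleftrightarrow> Vector_Spaces.linear smult (*) u"

definition mult_fun ::
  "complex poly \<Rightarrow> (complex poly \<Rightarrow> complex) \<Rightarrow> complex poly \<Rightarrow> complex" where
  "mult_fun p0 u p = u (p0 * p)"

definition dual_D :: "complex \<Rightarrow> complex set \<Rightarrow> (complex \<Rightarrow> complex) \<Rightarrow>
    (complex poly \<Rightarrow> complex) \<Rightarrow> complex poly \<Rightarrow> complex" where
  "dual_D h U X u p = - u (op_D h U X p)"

definition dual_S :: "complex \<Rightarrow> complex set \<Rightarrow> (complex \<Rightarrow> complex) \<Rightarrow>
    (complex poly \<Rightarrow> complex) \<Rightarrow> complex poly \<Rightarrow> complex" where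
  "dual_S h U X u p = u (op_S h U X p)"

definition at_square :: "complex poly \<Rightarrow> complex poly" where
  "at_square p = p \<circ>\<^sub>p monom 1 2"

definition sigma :: "(complex poly \<Rightarrow> complex) \<Rightarrow> complex poly \<Rightarrow> complex" where
  "sigma u p = u (at_square p)"

definition op_J :: "complex \<Rightarrow> complex poly \<Rightarrow> complex poly" where
  "op_J \<tau> p = (THE a. \<exists>b. p = at_square a + [:- \<tau>, 1:] * at_square b)"

definition dual_J ::
  "complex \<Rightarrow> (complex poly \<Rightarrow> complex) \<Rightarrow> complex poly \<Rightarrow> complex" where
  "dual_J \<tau> v p = v (op_J \<tau> p)"

text \<open>Only the members of the family with index in \<open>I\<close> matter.\<close>

definition orthogonal_family ::
  "nat set \<Rightarrow> (complex poly \<Rightarrow> complex) \<Rightarrow> (nat \<Rightarrow> complex poly) \<Rightarrow> bool" where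
  "orthogonal_family I u P \<longleftrightarrow>
     (\<forall>n\<in>I. degree (P n) = n) \<and>
     (\<forall>n\<in>I. \<forall>m\<in>I. m < n \<longrightarrow> u (P n * P m) = 0) \<and>
     (\<forall>n\<in>I. u ((P n)\<^sup>2) \<noteq> 0)"

definition monic_ops ::
  "nat set \<Rightarrow> (complex poly \<Rightarrow> complex) \<Rightarrow> (nat \<Rightarrow> complex poly) \<Rightarrow> bool" where
  "monic_ops I u P \<longleftrightarrow> orthogonal_family I u P \<and> (\<forall>n\<in>I. lead_coeff (P n) = 1)"

end

theory Submission
  imports Defs
begin

text \<open>Here \<open>Y = \<i> X\<close> and \<open>Z = - \<i> X\<close>, so for \<open>p = a(x\<^sup>2) + x b(x\<^sup>2)\<close> one has
  \<open>D p = b(- x\<^sup>2)\<close> and \<open>S p = a(- x\<^sup>2)\<close>. As \<open>a\<close> and \<open>b\<close> are independent,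
  \<open>D(\<phi> u) = S(\<psi> u)\<close> says that \<open>\<phi> u\<close> and \<open>\<psi> u\<close> both vanish on even polynomials;
  take \<open>\<psi>\<close> proportional to \<open>x - \<tau>\<close>. Then, with \<open>v = \<sigma> u\<close>, the functional \<open>u\<close> pairs
  \<open>a(x\<^sup>2) + (x - \<tau>) b(x\<^sup>2)\<close> with \<open>c(x\<^sup>2) + (x - \<tau>) d(x\<^sup>2)\<close> to
  \<open>v(a c) + v((x - \<tau>\<^sup>2) b d)\<close>: orthogonality for \<open>u\<close> splits into orthogonality for \<open>v\<close>
  and for \<open>(x - \<tau>\<^sup>2) v\<close>.\<close>

section \<open>Even and odd parts of polynomials\<close>

lemma at_square_add [simp]: "at_square (p + q) = at_square p + at_square q"
  by (simp add: at_square_def pcompose_add)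

lemma at_square_diff [simp]: "at_square (p - q) = at_square p - at_square q"
  by (simp add: at_square_def pcompose_diff)

lemma at_square_smult [simp]: "at_square (smult c p) = smult c (at_square p)"
  by (simp add: at_square_def pcompose_smult)

lemma at_square_mult [simp]: "at_square (p * q) = at_square p * at_square q"
  by (simp add: at_square_def pcompose_mult)

lemma at_square_0 [simp]: "at_square 0 = 0"
  by (simp add: at_square_def)

lemma at_square_1 [simp]: "at_square 1 = 1"
  by (simp add: at_square_def one_pCons pcompose_pCons)

lemma at_square_pCons: "at_square (pCons c p) = pCons c (pCons 0 (at_square p))"
  by (simp add: at_square_def pcompose_pCons monom_altdef power2_eq_square)

lemma poly_at_square [simp]: "poly (at_square p) x = poly p (x\<^sup>2)"
  by (simp add: at_square_def poly_pcompose poly_monom)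

lemma degree_at_square [simp]: "degree (at_square p) = 2 * degree p"
  by (simp add: at_square_def degree_pcompose degree_monom_eq)

lemma coeff_at_square_even [simp]: "coeff (at_square p) (2 * n) = coeff p n"
  by (induction p arbitrary: n) (auto simp: at_square_pCons coeff_pCons split: nat.splits)

lemma coeff_at_square_odd [simp]: "coeff (at_square p) (Suc (2 * n)) = 0"
proof (induction p arbitrary: n)
  case (pCons c p)
  then show ?case by (cases n) (auto simp: at_square_pCons)
qed simp

lemma coeff_linear_mult_Suc:
  fixes p :: "'a :: comm_ring_1 poly"
  shows "coeff ([:- c, 1:] * p) (Suc n) = coeff p n - c * coeff p (Suc n)"
  by (simp add: mult_pCons_left)

text \<open>\<open>at_square a\<close> has even powers only, and of (x - \<tau>) b(x^2) the factor x
  yields the odd powers and -\<tau> the even ones. So \<open>b\<close> is read off the odd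
  coefficients, after which the even ones yield \<open>a\<close>; uniqueness and the degree bounds
  below rest on this.\<close>

lemma coeff_even_odd_sum:
  "coeff (at_square a + [:- \<tau>, 1:] * at_square b) (2 * n) = coeff a n - \<tau> * coeff b n"
  "coeff (at_square a + [:- \<tau>, 1:] * at_square b) (Suc (2 * n)) = coeff b n"
proof -
  show "coeff (at_square a + [:- \<tau>, 1:] * at_square b) (2 * n) = coeff a n - \<tau> * coeff b n"
  proof (cases n)
    case 0
    then show ?thesis using coeff_at_square_even[of a 0] coeff_at_square_even[of b 0]
      by (simp add: mult_pCons_left)
  next
    case (Suc k)
    \<comment> \<open>In this form the predecessor of the index is visibly odd, where
      \<open>at_square b\<close> has coefficient 0.\<close>
    then have "2 * n = Suc (Suc (2 * k))" by simp
    then have "coeff ([:- \<tau>, 1:] * at_square b) (2 * n)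
        = coeff (at_square b) (Suc (2 * k)) - \<tau> * coeff (at_square b) (2 * n)"
      by (simp only: coeff_linear_mult_Suc)
    then show ?thesis by simp
  qed
  show "coeff (at_square a + [:- \<tau>, 1:] * at_square b) (Suc (2 * n)) = coeff b n"
    by (simp only: coeff_add coeff_linear_mult_Suc) simp
qed

lemma even_odd_decomposition:
  obtains a b where "p = at_square a + [:- \<tau>, 1:] * at_square b"
proof -
  have "\<exists>a b. p = at_square a + [:- \<tau>, 1:] * at_square b"
  proof (induction p)
    case 0
    show ?case by (intro exI[of _ 0]) simp
  next
    case (pCons c p)
    then obtain a b where p: "p = at_square a + [:- \<tau>, 1:] * at_square b" by blast
    \<comment> \<open>The new parts come from multiplying the old ones by x: x = \<tau> + (x -
      \<tau>) and x (x - \<tau>) = (x^2 - \<tau>^2) - \<tau> (x - \<tau>).\<close>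
    have "poly (pCons c p) x = poly (at_square ([:c:] + smult \<tau> a + [:- \<tau>\<^sup>2, 1:] * b)
        + [:- \<tau>, 1:] * at_square (a - smult \<tau> b)) x" for x
      unfolding p by (simp add: algebra_simps power2_eq_square)
    then show ?case by (metis poly_ext)
  qed
  then show thesis using that by blast
qed

lemma even_odd_unique:
  assumes "at_square a + [:- \<tau>, 1:] * at_square b = at_square c + [:- \<tau>, 1:] * at_square d"
  shows "a = c" "b = d"
proof -
  show bd: "b = d"
    using coeff_even_odd_sum(2)[of a \<tau> b] coeff_even_odd_sum(2)[of c \<tau> d] assms
    by (intro poly_eqI) metis
  show "a = c"
    using coeff_even_odd_sum(1)[of a \<tau> b] coeff_even_odd_sum(1)[of c \<tau> d] assms bd
    by (intro poly_eqI) (metis diff_add_cancel)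
qed

lemma op_J_sum [simp]: "op_J \<tau> (at_square a + [:- \<tau>, 1:] * at_square b) = a"
  unfolding op_J_def using even_odd_unique by (intro the_equality) metis+

lemma op_J_at_square [simp]: "op_J \<tau> (at_square a) = a"
  using op_J_sum[of \<tau> a 0] by simp

lemma op_J_linear_times_at_square: "op_J \<tau> ([:- \<tau>, 1:] * at_square b) = 0"
  using op_J_sum[of \<tau> 0 b] by (simp only: at_square_0 add_0)

text \<open>For k > n both coefficients 2k + 1 and 2k of the sum vanish: the first is that of
  \<open>b\<close> at k, and then the second reduces to that of \<open>a\<close>.\<close>

lemma degree_even_part_le:
  assumes "degree (at_square a + [:- \<tau>, 1:] * at_square b) \<le> 2 * n"
  shows "degree a \<le> n"
proof (rule degree_le, intro allI impI)
  fix k assume "n < k"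
  then have "coeff (at_square a + [:- \<tau>, 1:] * at_square b) (2 * k) = 0"
    "coeff (at_square a + [:- \<tau>, 1:] * at_square b) (Suc (2 * k)) = 0"
    using assms by (auto intro!: coeff_eq_0 simp del: coeff_add)
  then show "coeff a k = 0"
    by (simp only: coeff_even_odd_sum) simp
qed

lemma degree_odd_part_le:
  assumes "degree (at_square a + [:- \<tau>, 1:] * at_square b) \<le> Suc (2 * n)"
  shows "degree b \<le> n"
proof (rule degree_le, intro allI impI)
  fix k assume "n < k"
  then have "coeff (at_square a + [:- \<tau>, 1:] * at_square b) (Suc (2 * k)) = 0"
    using assms by (auto intro!: coeff_eq_0 simp del: coeff_add)
  then show "coeff b k = 0"
    by (simp only: coeff_even_odd_sum)
qed

lemma degree_linear_times:
  fixes p :: "'a :: idom poly"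
  assumes "p \<noteq> 0"
  shows "degree ([:- c, 1:] * p) = Suc (degree p)"
  using assms by (subst degree_mult_eq) auto

lemma lead_coeff_at_square [simp]: "lead_coeff (at_square p) = lead_coeff p"
  by simp

lemma lead_coeff_linear_times:
  fixes p :: "'a :: idom poly"
  shows "lead_coeff ([:- c, 1:] * p) = lead_coeff p"
  by (subst lead_coeff_mult) simp

section \<open>Linear functionals and monic orthogonal polynomials\<close>

lemma functional_iff:
  "functional u \<longleftrightarrow> (\<forall>p q. u (p + q) = u p + u q) \<and> (\<forall>c p. u (smult c p) = c * u p)"
proof
  assume "functional u"
  then interpret Vector_Spaces.linear smult "(*)" u by (simp add: functional_def)
  show "(\<forall>p q. u (p + q) = u p + u q) \<and> (\<forall>c p. u (smult c p) = c * u p)"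
    by (simp add: add scale)
next
  assume "(\<forall>p q. u (p + q) = u p + u q) \<and> (\<forall>c p. u (smult c p) = c * u p)"
  then show "functional u"
    unfolding functional_def
    by unfold_locales (auto simp: algebra_simps smult_add_right smult_add_left)
qed

lemma functional_add: "functional u \<Longrightarrow> u (p + q) = u p + u q"
  and functional_smult: "functional u \<Longrightarrow> u (smult c p) = c * u p"
  by (simp_all add: functional_iff)

lemma functional_zero: "functional u \<Longrightarrow> u 0 = 0"
  using functional_smult[of u 0 0] by simp

lemma functional_diff: "functional u \<Longrightarrow> u (p - q) = u p - u q"
  using functional_add[of u "p - q" q] by simp

lemma functional_sigma: "functional u \<Longrightarrow> functional (sigma u)"
  by (simp add: functional_iff sigma_def)

lemma monic_opsD:
  assumes "monic_ops I u P" "n \<in> I"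
  shows "degree (P n) = n" "coeff (P n) n = 1" "u ((P n)\<^sup>2) \<noteq> 0" "P n \<noteq> 0"
    and "m \<in> I \<Longrightarrow> m < n \<Longrightarrow> u (P n * P m) = 0"
  using assms unfolding monic_ops_def orthogonal_family_def by force+

text \<open>The coefficients at \<open>n\<close> cancel. The difference has to be non-zero because 0
  has degree 0, which is not below \<open>n\<close> when \<open>n = 0\<close>.\<close>

lemma degree_minus_leading_term_less:
  fixes q r :: "'a :: comm_ring_1 poly"
  assumes "degree q \<le> n" "degree r = n" "coeff r n = 1" "q - smult (coeff q n) r \<noteq> 0"
  shows "degree (q - smult (coeff q n) r) < n"
proof -
  have "degree (q - smult (coeff q n) r) \<le> n"
    using assms by (intro degree_diff_le) (auto intro: order_trans[OF degree_smult_le])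
  moreover have "degree (q - smult (coeff q n) r) \<noteq> n"
    using assms leading_coeff_neq_0[of "q - smult (coeff q n) r"] by auto
  ultimately show ?thesis by simp
qed

text \<open>Strong induction on the degree m of \<open>q\<close>: removing the leading term by a
  multiple of \<open>P m\<close> leaves 0 or a polynomial of smaller degree. Downward closure of
  \<open>I\<close> ensures that \<open>P m\<close> belongs to the family.\<close>

lemma monic_ops_orthogonal_lower_degree:
  assumes u: "functional u" and P: "monic_ops I u P" and I: "\<And>m n. n \<in> I \<Longrightarrow> m \<le> n \<Longrightarrow> m \<in> I"
    and n: "n \<in> I" and "degree q < n"
  shows "u (P n * q) = 0"
  using \<open>degree q < n\<close>
proof (induction "degree q" arbitrary: q rule: less_induct)
  case less
  define m where "m = degree q"
  have m: "m \<in> I" using I[OF n, of m] less.prems by (simp add: m_def)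
  define d where "d = q - smult (coeff q m) (P m)"
  have "u (P n * d) = 0"
  proof (cases "d = 0")
    case False
    then have "degree d < m"
      unfolding d_def using monic_opsD[OF P m] by (intro degree_minus_leading_term_less) (auto simp: m_def)
    then show ?thesis using less m_def by simp
  qed (simp add: functional_zero[OF u])
  moreover have "P n * q = P n * d + smult (coeff q m) (P n * P m)"
    by (simp add: d_def algebra_simps)
  moreover have "u (P n * P m) = 0"
    using monic_opsD(5)[OF P n m] less.prems by (simp add: m_def)
  ultimately show ?case by (simp add: functional_add[OF u] functional_smult[OF u])
qed

text \<open>Modulo lower degree \<open>q\<close> is \<open>coeff q n\<close> times
  \<open>P n\<close>. Stating the value through this coefficient covers lower degrees and q = 0 as
  well.\<close>

lemma monic_ops_pairing:
  assumes u: "functional u" and P: "monic_ops I u P" and I: "\<And>m n. n \<in> I \<Longrightarrow> m \<le> n \<Longrightarrow> m \<in> I"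
    and n: "n \<in> I" and q: "degree q \<le> n"
  shows "u (P n * q) = coeff q n * u ((P n)\<^sup>2)"
proof -
  define d where "d = q - smult (coeff q n) (P n)"
  have "u (P n * d) = 0"
  proof (cases "d = 0")
    case False
    then have "degree d < n"
      unfolding d_def using monic_opsD[OF P n] q by (intro degree_minus_leading_term_less) auto
    then show ?thesis using monic_ops_orthogonal_lower_degree[OF u P I n] by simp
  qed (simp add: functional_zero[OF u])
  moreover have "P n * q = P n * d + smult (coeff q n) ((P n)\<^sup>2)"
    by (simp add: d_def algebra_simps power2_eq_square)
  ultimately show ?thesis by (simp add: functional_add[OF u] functional_smult[OF u])
qed

lemma monic_opsI:
  assumes "\<And>n. n \<in> I \<Longrightarrow> degree (P n) = n" "\<And>n. n \<in> I \<Longrightarrow> coeff (P n) n = 1"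
    and "\<And>n q. n \<in> I \<Longrightarrow> degree q < n \<Longrightarrow> u (P n * q) = 0"
    and "\<And>n. n \<in> I \<Longrightarrow> u (P n * P n) \<noteq> 0"
  shows "monic_ops I u P"
  using assms by (auto simp: monic_ops_def orthogonal_family_def power2_eq_square)

text \<open>A non-zero difference d of two monic members has degree m < n. Both members are
  orthogonal to \<open>P m\<close>, hence so is d; but pairing d with \<open>P m\<close> gives its
  leading coefficient times a non-zero norm.\<close>

lemma monic_ops_unique:
  assumes u: "functional u" and P: "monic_ops I u P" and Q: "monic_ops I u Q"
    and I: "\<And>m n. n \<in> I \<Longrightarrow> m \<le> n \<Longrightarrow> m \<in> I" and n: "n \<in> I"
  shows "P n = Q n"
proof (rule ccontr)
  assume "P n \<noteq> Q n"
  define d where "d = P n - Q n"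
  have d0: "d \<noteq> 0" using \<open>P n \<noteq> Q n\<close> by (simp add: d_def)
  have "degree d < n"
    using degree_minus_leading_term_less[of "P n" n "Q n"] monic_opsD[OF P n] monic_opsD[OF Q n] d0
    by (simp add: d_def)
  then have m: "degree d \<in> I" using I[OF n] by simp
  have "u (P n * P (degree d)) = 0" "u (Q n * P (degree d)) = 0"
    using monic_ops_orthogonal_lower_degree[OF u _ I n] P Q monic_opsD(1)[OF P m] \<open>degree d < n\<close>
    by simp_all
  moreover have "P (degree d) * d = P n * P (degree d) - Q n * P (degree d)"
    by (simp add: d_def algebra_simps)
  ultimately have "u (P (degree d) * d) = 0"
    by (simp only: functional_diff[OF u]) simp
  then show False
    using monic_ops_pairing[OF u P I m, where q = d] monic_opsD(3)[OF P m] d0 by simp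
qed

section \<open>The divided difference and averaging operators\<close>

lemma poly_eq_of_infinite:
  fixes p q :: "'a :: idom poly"
  assumes "infinite A" "\<And>x. x \<in> A \<Longrightarrow> poly p x = poly q x"
  shows "p = q"
proof (rule ccontr)
  assume "p \<noteq> q"
  then have "finite {x. poly (p - q) x = 0}" by (intro poly_roots_finite) simp
  moreover have "A \<subseteq> {x. poly (p - q) x = 0}" using assms(2) by auto
  ultimately show False using assms(1) finite_subset by blast
qed

text \<open>A shift by h/2 changes the exponent by \<i> pi/2, and exp(\<i> pi/2) = \<i>.\<close>

lemma shifts_exp:
  assumes "h \<noteq> 0" "half_step_invariant h U" "\<forall>s\<in>U. X s = exp (of_real pi * \<i> * s / h)" "s \<in> U"
  shows "shift_Y h X s = \<i> * X s" "shift_Z h X s = - \<i> * X s" "X s \<noteq> 0"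
proof -
  have U: "s + h / 2 \<in> U" "s - h / 2 \<in> U"
    using assms(2,4) by (auto simp: half_step_invariant_def)
  have e: "of_real pi * \<i> * (s + h / 2) / h = of_real pi * \<i> * s / h + \<i> * of_real (pi / 2)"
    "of_real pi * \<i> * (s - h / 2) / h = of_real pi * \<i> * s / h - \<i> * of_real (pi / 2)"
    using assms(1) by (simp_all add: field_simps)
  have c: "exp (\<i> * of_real (pi / 2)) = \<i>"
    using cis_pi_half cis_conv_exp by simp
  show "shift_Y h X s = \<i> * X s"
    unfolding shift_Y_def assms(3)[rule_format, OF U(1)] assms(3)[rule_format, OF assms(4)] e(1) exp_add c
    by simp
  show "shift_Z h X s = - \<i> * X s"
    unfolding shift_Z_def assms(3)[rule_format, OF U(2)] assms(3)[rule_format, OF assms(4)] e(2) exp_diff c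
    by simp
  show "X s \<noteq> 0" using assms(3,4) by simp
qed

text \<open>Y and Z have the same square -X^2, so the values of a and b at Y^2 and Z^2 agree: the
  difference cancels a, and the mean cancels b since Y + Z = 0. Infinitude of X(U) makes the
  polynomial picked by \<open>THE\<close> unique.\<close>

lemma op_D_op_S_exp:
  assumes "h \<noteq> 0" "half_step_invariant h U" "\<forall>s\<in>U. X s = exp (of_real pi * \<i> * s / h)"
    and "infinite (X ` U)"
  shows "op_D h U X (at_square a + [:0, 1:] * at_square b) = at_square (b \<circ>\<^sub>p [:0, - 1:])"
    and "op_S h U X (at_square a + [:0, 1:] * at_square b) = at_square (a \<circ>\<^sub>p [:0, - 1:])"
proof -
  let ?p = "at_square a + [:0, 1:] * at_square b"
  have D: "divided_diff h X ?p s = poly (at_square (b \<circ>\<^sub>p [:0, - 1:])) (X s)"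
    and S: "average h X ?p s = poly (at_square (a \<circ>\<^sub>p [:0, - 1:])) (X s)" if "s \<in> U" for s
  proof -
    note sh = shifts_exp[OF assms(1-3) that]
    have sq: "(\<i> * X s)\<^sup>2 = - (X s)\<^sup>2" "(- \<i> * X s)\<^sup>2 = - (X s)\<^sup>2"
      by (simp_all add: power_mult_distrib)
    show "divided_diff h X ?p s = poly (at_square (b \<circ>\<^sub>p [:0, - 1:])) (X s)"
      unfolding divided_diff_def sh(1,2) using sh(3)
      by (simp add: poly_pcompose sq[simplified] field_simps)
    show "average h X ?p s = poly (at_square (a \<circ>\<^sub>p [:0, - 1:])) (X s)"
      unfolding average_def sh(1,2)
      by (simp add: poly_pcompose sq[simplified])
  qed
  show "op_D h U X ?p = at_square (b \<circ>\<^sub>p [:0, - 1:])"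
    unfolding op_D_def
  proof (rule the_equality)
    fix q assume "\<forall>s\<in>U. poly q (X s) = divided_diff h X ?p s"
    then show "q = at_square (b \<circ>\<^sub>p [:0, - 1:])"
      using D by (intro poly_eq_of_infinite[OF assms(4)]) auto
  qed (use D in simp)
  show "op_S h U X ?p = at_square (a \<circ>\<^sub>p [:0, - 1:])"
    unfolding op_S_def
  proof (rule the_equality)
    fix q assume "\<forall>s\<in>U. poly q (X s) = average h X ?p s"
    then show "q = at_square (a \<circ>\<^sub>p [:0, - 1:])"
      using S by (intro poly_eq_of_infinite[OF assms(4)]) auto
  qed (use S in simp)
qed

lemma pearson_equation_exp_iff:
  assumes "h \<noteq> 0" "half_step_invariant h U" "\<forall>s\<in>U. X s = exp (of_real pi * \<i> * s / h)"
    and "infinite (X ` U)" and u: "functional u"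
  shows "dual_D h U X (mult_fun \<phi> u) = dual_S h U X (mult_fun \<psi> u) \<longleftrightarrow>
    (\<forall>r. u (\<phi> * at_square r) = 0 \<and> u (\<psi> * at_square r) = 0)"
proof
  note ops = op_D_op_S_exp[OF assms(1-4)]
  let ?r' = "\<lambda>r. r \<circ>\<^sub>p [:0, - 1:]"
  assume "dual_D h U X (mult_fun \<phi> u) = dual_S h U X (mult_fun \<psi> u)"
  then have eq: "- u (\<phi> * at_square (?r' b)) = u (\<psi> * at_square (?r' a))" for a b
    using ops[of a b] unfolding dual_D_def dual_S_def mult_fun_def by (metis (no_types))
  have inv: "?r' (?r' r) = r" for r :: "complex poly"
    by (rule poly_ext) (simp add: poly_pcompose)
  \<comment> \<open>Setting one of the two parts to 0 isolates one side of \<open>eq\<close>. The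
    reflection x -> -x is an involution, so every \<open>r\<close> is reached.\<close>
  have "u (\<phi> * at_square r) = 0 \<and> u (\<psi> * at_square r) = 0" for r
    using eq[of "?r' r" 0] eq[of 0 "?r' r"] by (simp add: inv functional_zero[OF u])
  then show "\<forall>r. u (\<phi> * at_square r) = 0 \<and> u (\<psi> * at_square r) = 0" by blast
next
  note ops = op_D_op_S_exp[OF assms(1-4)]
  assume z: "\<forall>r. u (\<phi> * at_square r) = 0 \<and> u (\<psi> * at_square r) = 0"
  show "dual_D h U X (mult_fun \<phi> u) = dual_S h U X (mult_fun \<psi> u)"
  proof
    fix p
    obtain a b where "p = at_square a + [:- 0, 1:] * at_square b"
      by (rule even_odd_decomposition)
    then have p: "p = at_square a + [:0, 1:] * at_square b" by simp
    show "dual_D h U X (mult_fun \<phi> u) p = dual_S h U X (mult_fun \<psi> u) p"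
      unfolding dual_D_def dual_S_def mult_fun_def p ops using z by simp
  qed
qed

section \<open>Functionals in the range of the transposed even-part operator\<close>

lemma dual_J_vanishes:
  assumes "functional v"
  shows "dual_J \<tau> v ([:- \<tau>, 1:] * at_square r) = 0"
  unfolding dual_J_def op_J_linear_times_at_square using functional_zero[OF assms] .

text \<open>This recovers v from u whatever \<tau> is, hence the uniqueness of v; the next lemma is
  the converse on functionals satisfying (ii).\<close>

lemma sigma_dual_J: "sigma (dual_J \<tau> v) = v"
  by (rule ext) (simp add: sigma_def dual_J_def)

lemma dual_J_sigma:
  assumes u: "functional u" and z: "\<forall>r. u ([:- \<tau>, 1:] * at_square r) = 0"
  shows "dual_J \<tau> (sigma u) = u"
proof
  fix p
  obtain a b where p: "p = at_square a + [:- \<tau>, 1:] * at_square b"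
    by (rule even_odd_decomposition)
  show "dual_J \<tau> (sigma u) p = u p"
    unfolding p dual_J_def sigma_def op_J_sum using z by (simp only: functional_add[OF u]) simp
qed

text \<open>The case r = 1 of the hypothesis already reads u(x) = \<tau> u(1).\<close>

lemma vanishing_parameter:
  assumes u: "functional u" and "u 1 \<noteq> 0" and z: "\<forall>r. u ([:- \<tau>, 1:] * at_square r) = 0"
  shows "\<tau> = u [:0, 1:] / u 1"
proof -
  have "[:- \<tau>, 1:] * at_square 1 = [:0, 1:] - smult \<tau> 1" by simp
  then have "u [:0, 1:] - \<tau> * u 1 = 0"
    using z functional_diff[OF u] functional_smult[OF u] by metis
  then show ?thesis using assms(2) by (simp add: field_simps)
qed

section \<open>The bilinear form of u in terms of v\<close>

locale even_part_functional =
  fixes u v :: "complex poly \<Rightarrow> complex" and \<tau> :: complex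
  assumes functional_u: "functional u" and functional_v: "functional v"
    and u_eq: "u = dual_J \<tau> v"
begin

abbreviation "L \<equiv> [:- \<tau>, 1:]"
abbreviation "M \<equiv> [:- \<tau>\<^sup>2, 1:]"

lemma u_at_square: "u (at_square a) = v a"
  by (simp add: u_eq dual_J_def)

lemma u_linear: "u (L * at_square b) = 0"
  unfolding u_eq using functional_v by (rule dual_J_vanishes)

text \<open>Since (x - \<tau>)^2 = (x^2 - \<tau>^2) - 2 \<tau> (x - \<tau>), the product of the two
  odd parts contributes M b d evaluated at x^2 plus a term killed by \<open>u\<close>; the mixed
  products are killed too.\<close>

lemma pairing:
  "u ((at_square a + L * at_square b) * (at_square c + L * at_square d)) = v (a * c) + v (M * b * d)"
proof -
  have "(at_square a + L * at_square b) * (at_square c + L * at_square d)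
      = at_square (a * c + M * b * d) + L * at_square (a * d + b * c - smult (2 * \<tau>) (b * d))"
    by (rule poly_ext) (simp add: algebra_simps power2_eq_square)
  then show ?thesis
    by (simp only: functional_add[OF functional_u] functional_add[OF functional_v] u_at_square u_linear)
      simp
qed

lemma pairing_even: "u (at_square a * (at_square c + L * at_square d)) = v (a * c)"
  using pairing[of a 0 c d] by (simp add: functional_zero[OF functional_v] del: mult_pCons_left)

lemma pairing_odd: "u (L * at_square b * (at_square c + L * at_square d)) = v (M * b * d)"
  using pairing[of 0 b c d] by (simp add: functional_zero[OF functional_v] del: mult_pCons_left)

end

section \<open>Index sets and the passage from R to P\<close>

locale even_part_functional_index = even_part_functional +
  fixes I J K :: "nat set"
  assumes index: "(I = UNIV \<and> J = UNIV \<and> K = UNIV) \<or>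
    (\<exists>N. I = {0..2 * N + 2} \<and> J = {0..N + 1} \<and> K = {0..N})"
begin

lemma index_down:
  "n \<in> I \<Longrightarrow> m \<le> n \<Longrightarrow> m \<in> I" "n \<in> J \<Longrightarrow> m \<le> n \<Longrightarrow> m \<in> J" "n \<in> K \<Longrightarrow> m \<le> n \<Longrightarrow> m \<in> K"
  using index by auto

text \<open>In the finite case the top index 2N + 2 of \<open>I\<close> is even and its last odd
  index is 2N + 1, so \<open>J\<close> reaches one step further than \<open>K\<close>.\<close>

lemma even_mem_I: "2 * n \<in> I \<longleftrightarrow> n \<in> J"
  and odd_mem_I: "Suc (2 * n) \<in> I \<longleftrightarrow> n \<in> K"
  and Suc_mem_J: "Suc n \<in> J \<longleftrightarrow> n \<in> K"
  using index by auto

lemma mem_K_imp_mem_J: "n \<in> K \<Longrightarrow> n \<in> J"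
  using index by auto

text \<open>The kernel (Christoffel) polynomials of \<open>R\<close> at \<open>\<tau>\<^sup>2\<close>.\<close>

definition ker_num :: "(nat \<Rightarrow> complex poly) \<Rightarrow> nat \<Rightarrow> complex poly" where
  "ker_num R n = R (n + 1) - smult (poly (R (n + 1)) (\<tau>\<^sup>2) / poly (R n) (\<tau>\<^sup>2)) (R n)"

definition ker_poly :: "(nat \<Rightarrow> complex poly) \<Rightarrow> nat \<Rightarrow> complex poly" where
  "ker_poly R n = ker_num R n div M"

context
  fixes R
  assumes R: "monic_ops J v R" and R_nz: "\<forall>n\<in>J. poly (R n) (\<tau>\<^sup>2) \<noteq> 0"
begin

lemma ker_num_dvd:
  assumes "n \<in> K"
  shows "M dvd ker_num R n"
  using R_nz mem_K_imp_mem_J[OF assms] by (auto simp: ker_num_def poly_eq_0_iff_dvd[symmetric])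

lemma M_times_ker_poly:
  assumes "n \<in> K"
  shows "M * ker_poly R n = ker_num R n"
  unfolding ker_poly_def using ker_num_dvd[OF assms] by (rule dvd_mult_div_cancel)

lemma ker_poly_degree:
  assumes n: "n \<in> K"
  shows "degree (ker_poly R n) = n" "coeff (ker_poly R n) n = 1"
proof -
  note R1 = monic_opsD[OF R Suc_mem_J[THEN iffD2, OF n]] and R0 = monic_opsD[OF R mem_K_imp_mem_J[OF n]]
  let ?c = "poly (R (n + 1)) (\<tau>\<^sup>2) / poly (R n) (\<tau>\<^sup>2)"
  have c: "coeff (ker_num R n) (Suc n) = 1"
    using R1(1,2) R0(1) by (simp add: ker_num_def coeff_eq_0)
  have "degree (ker_num R n) \<le> Suc n"
    unfolding ker_num_def using R1(1) R0(1)
    by (intro degree_diff_le) (auto intro: order_trans[OF degree_smult_le])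
  then have d: "degree (ker_num R n) = Suc n"
    using c by (intro antisym le_degree) auto
  have nz: "ker_poly R n \<noteq> 0" using c M_times_ker_poly[OF n] by auto
  show d': "degree (ker_poly R n) = n"
    using degree_linear_times[OF nz, of "\<tau>\<^sup>2"] M_times_ker_poly[OF n] d by simp
  show "coeff (ker_poly R n) n = 1"
    using lead_coeff_linear_times[of "\<tau>\<^sup>2" "ker_poly R n"] c
    by (simp only: M_times_ker_poly[OF n] d d')
qed

text \<open>Multiplication by \<open>M\<close> turns the kernel polynomial back into R_{n+1} - c
  R_n. As deg q \<le> n, R_{n+1} drops out and only the R_n term survives. This yields orthogonality
  when deg q < n, and a non-zero norm for q = \<open>ker_poly R n\<close> because c is
  non-zero.\<close>

lemma ker_poly_pairing:
  assumes n: "n \<in> K" and q: "degree q \<le> n"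
  shows "v (M * ker_poly R n * q)
    = - (poly (R (n + 1)) (\<tau>\<^sup>2) / poly (R n) (\<tau>\<^sup>2)) * (coeff q n * v ((R n)\<^sup>2))"
proof -
  let ?c = "poly (R (n + 1)) (\<tau>\<^sup>2) / poly (R n) (\<tau>\<^sup>2)"
  have "M * ker_poly R n * q = R (n + 1) * q - smult ?c (R n * q)"
    unfolding M_times_ker_poly[OF n] by (simp add: ker_num_def algebra_simps)
  moreover have "v (R (n + 1) * q) = 0"
    using q Suc_mem_J[THEN iffD2, OF n]
    by (intro monic_ops_orthogonal_lower_degree[OF functional_v R index_down(2)]) auto
  moreover have "v (R n * q) = coeff q n * v ((R n)\<^sup>2)"
    using q mem_K_imp_mem_J[OF n] by (intro monic_ops_pairing[OF functional_v R index_down(2)]) auto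
  ultimately show ?thesis
    by (simp add: functional_diff[OF functional_v] functional_smult[OF functional_v])
qed

lemma ker_poly_norm:
  assumes n: "n \<in> K"
  shows "v (M * ker_poly R n * ker_poly R n) \<noteq> 0"
  using ker_poly_pairing[OF n, of "ker_poly R n"] ker_poly_degree[OF n] R_nz
    Suc_mem_J[THEN iffD2, OF n] mem_K_imp_mem_J[OF n] monic_opsD(3)[OF R mem_K_imp_mem_J[OF n]]
  by simp

lemma monic_ops_ker_poly: "monic_ops K (mult_fun M v) (ker_poly R)"
proof (rule monic_opsI)
  fix n and q :: "complex poly" assume n: "n \<in> K" and q: "degree q < n"
  then have "v (M * ker_poly R n * q) = 0"
    using ker_poly_pairing[OF n, of q] by (simp add: coeff_eq_0)
  then show "mult_fun M v (ker_poly R n * q) = 0"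
    by (simp only: mult_fun_def mult.assoc)
next
  fix n assume "n \<in> K"
  then show "mult_fun M v (ker_poly R n * ker_poly R n) \<noteq> 0"
    using ker_poly_norm by (simp only: mult_fun_def mult.assoc not_False_eq_True)
qed (use ker_poly_degree in auto)

definition interlaced :: "nat \<Rightarrow> complex poly" where
  "interlaced k = (if even k then at_square (R (k div 2)) else L * at_square (ker_poly R (k div 2)))"

lemma interlaced_even: "interlaced (2 * n) = at_square (R n)"
  and interlaced_odd: "interlaced (Suc (2 * n)) = L * at_square (ker_poly R n)"
  by (simp_all add: interlaced_def)

text \<open>By the pairing formulas an even member sees only the even part of \<open>q\<close>,
  through \<open>v\<close>, and an odd member only the odd part, through (x - \<tau>^2) v;
  orthogonality and norms are thus inherited from \<open>R\<close> and its kernel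
  polynomials.\<close>

lemma monic_ops_interlaced: "monic_ops I u interlaced"
proof (rule monic_opsI)
  have *: "degree (interlaced k) = k \<and> lead_coeff (interlaced k) = 1" if "k \<in> I" for k
  proof (cases "even k")
    case True
    then obtain n where k: "k = 2 * n" by (elim evenE)
    then have "n \<in> J" using that even_mem_I by simp
    from monic_opsD(1,2)[OF R this] show ?thesis
      unfolding k interlaced_even lead_coeff_at_square by simp
  next
    case False
    then obtain n where "k = 2 * n + 1" by (elim oddE)
    then have k: "k = Suc (2 * n)" by simp
    then have "n \<in> K" using that odd_mem_I by simp
    note d = ker_poly_degree[OF this]
    then have "at_square (ker_poly R n) \<noteq> 0"
      by (metis lead_coeff_at_square leading_coeff_0_iff zero_neq_one)
    then show ?thesis
      unfolding k interlaced_odd lead_coeff_linear_times lead_coeff_at_square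
      by (simp only: degree_linear_times degree_at_square d simp_thms not_False_eq_True)
  qed
  fix k assume k: "k \<in> I"
  show "degree (interlaced k) = k" "coeff (interlaced k) k = 1" using *[OF k] by auto
next
  fix k and q :: "complex poly" assume k: "k \<in> I" and q: "degree q < k"
  obtain c d where qcd: "q = at_square c + L * at_square d" by (rule even_odd_decomposition)
  show "u (interlaced k * q) = 0"
  proof (cases "even k")
    case True
    then obtain n where kn: "k = 2 * n" by (elim evenE)
    then have n: "n \<in> J" using k even_mem_I by simp
    have "coeff d n = 0"
      using coeff_even_odd_sum(2)[of c \<tau> d n, folded qcd] q kn by (simp add: coeff_eq_0)
    then have "coeff c n = 0"
      using coeff_even_odd_sum(1)[of c \<tau> d n, folded qcd] q kn by (simp add: coeff_eq_0)
    moreover have "degree c \<le> n"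
      using degree_even_part_le[of c \<tau> d n, folded qcd] q kn by simp
    ultimately have "v (R n * c) = 0"
      using monic_ops_pairing[OF functional_v R index_down(2) n, where q = c] by simp
    then show ?thesis unfolding kn interlaced_even qcd pairing_even .
  next
    case False
    then obtain n where "k = 2 * n + 1" by (elim oddE)
    then have kn: "k = Suc (2 * n)" by simp
    then have n: "n \<in> K" using k odd_mem_I by simp
    \<comment> \<open>Coefficient and degree bound are kept apart: for \<open>n = 0\<close> the
      polynomial \<open>q\<close> is constant and d = 0, whose degree is not below
      \<open>n\<close>.\<close>
    have "coeff d n = 0"
      using coeff_even_odd_sum(2)[of c \<tau> d n, folded qcd] q kn by (simp add: coeff_eq_0)
    moreover have "degree d \<le> n"
      using degree_odd_part_le[of c \<tau> d n, folded qcd] q kn by simp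
    ultimately have "v (M * ker_poly R n * d) = 0"
      using ker_poly_pairing[OF n, of d] by simp
    then show ?thesis unfolding kn interlaced_odd qcd pairing_odd .
  qed
next
  fix k assume k: "k \<in> I"
  show "u (interlaced k * interlaced k) \<noteq> 0"
  proof (cases "even k")
    case True
    then obtain n where kn: "k = 2 * n" by (elim evenE)
    then have n: "n \<in> J" using k even_mem_I by simp
    have "u (interlaced k * interlaced k) = v ((R n)\<^sup>2)"
      unfolding kn interlaced_even power2_eq_square at_square_mult[symmetric] by (rule u_at_square)
    then show ?thesis using monic_opsD(3)[OF R n] by simp
  next
    case False
    then obtain n where "k = 2 * n + 1" by (elim oddE)
    then have kn: "k = Suc (2 * n)" by simp
    then have n: "n \<in> K" using k odd_mem_I by simp
    have "u (interlaced k * interlaced k) = v (M * ker_poly R n * ker_poly R n)"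
      unfolding kn interlaced_odd
      using pairing_odd[of "ker_poly R n" 0 "ker_poly R n"] by (simp only: at_square_0 add_0)
    then show ?thesis using ker_poly_norm[OF n] by simp
  qed
qed

end

section \<open>The passage from P back to R\<close>

context
  fixes P
  assumes P: "monic_ops I u P"
begin

text \<open>Pairing P_{2n} with q(x^2) under \<open>u\<close> involves only the even part of P_{2n}
  and equals its pairing with q under \<open>v\<close>.\<close>

lemma monic_ops_even_part: "monic_ops J v (\<lambda>n. op_J \<tau> (P (2 * n)))"
proof -
  have deg: "degree (op_J \<tau> (P (2 * n))) \<le> n" and coeff: "coeff (op_J \<tau> (P (2 * n))) n = 1"
    and pair: "v (op_J \<tau> (P (2 * n)) * q) = u (P (2 * n) * at_square q)" if n: "n \<in> J" for n q
  proof -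
    note Pn = monic_opsD[OF P even_mem_I[THEN iffD2, OF n]]
    obtain a b where ab: "P (2 * n) = at_square a + [:- \<tau>, 1:] * at_square b"
      by (rule even_odd_decomposition)
    have J: "op_J \<tau> (P (2 * n)) = a" unfolding ab by (rule op_J_sum)
    show "degree (op_J \<tau> (P (2 * n))) \<le> n"
      using degree_even_part_le[of a \<tau> b n, folded ab] Pn(1) J by simp
    \<comment> \<open>This is the coefficient of P_{2n} at 2n + 1; once it vanishes, the leading
      coefficient at 2n belongs to the even part alone.\<close>
    have "coeff b n = 0"
      using coeff_even_odd_sum(2)[of a \<tau> b n, folded ab] Pn(1) by (simp add: coeff_eq_0)
    then show "coeff (op_J \<tau> (P (2 * n))) n = 1"
      using coeff_even_odd_sum(1)[of a \<tau> b n, folded ab] Pn(2) J by simp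
    have "u (P (2 * n) * at_square q) = u (at_square q * (at_square a + [:- \<tau>, 1:] * at_square b))"
      unfolding ab by (rule arg_cong[of _ _ u]) (rule mult.commute)
    also have "\<dots> = v (a * q)" unfolding pairing_even by (simp only: mult.commute)
    finally show "v (op_J \<tau> (P (2 * n)) * q) = u (P (2 * n) * at_square q)"
      by (simp only: J)
  qed
  show ?thesis
  proof (rule monic_opsI)
    fix n assume n: "n \<in> J"
    note Pn = monic_opsD[OF P even_mem_I[THEN iffD2, OF n]]
    show d: "degree (op_J \<tau> (P (2 * n))) = n"
      using deg[OF n] coeff[OF n] by (intro antisym le_degree) auto
    show "coeff (op_J \<tau> (P (2 * n))) n = 1" by (rule coeff[OF n])
    show "v (op_J \<tau> (P (2 * n)) * q) = 0" if "degree q < n" for q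
      unfolding pair[OF n] using that n
      by (intro monic_ops_orthogonal_lower_degree[OF functional_u P index_down(1)])
        (auto simp: even_mem_I)
    show "v (op_J \<tau> (P (2 * n)) * op_J \<tau> (P (2 * n))) \<noteq> 0"
      unfolding pair[OF n]
      \<comment> \<open>This \<open>q\<close> is monic of degree 2n, so its pairing with P_{2n} is
        the norm of P_{2n}.\<close>
      using monic_ops_pairing[OF functional_u P index_down(1), where n = "2 * n" and q = "at_square (op_J \<tau> (P (2 * n)))"]
        n d Pn(3) coeff[OF n] by (simp add: even_mem_I)
  qed
qed

text \<open>If \<open>R\<^sub>n = (x - \<tau>\<^sup>2) T\<close>, then \<open>(x - \<tau>) T(x\<^sup>2)\<close> has degree \<open>2 n - 1\<close> and is orthogonal to all
  polynomials of degree at most \<open>2 n - 1\<close>.\<close>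

lemma monic_ops_nonzero_at_square:
  assumes R: "monic_ops J v R" and n: "n \<in> J"
  shows "poly (R n) (\<tau>\<^sup>2) \<noteq> 0"
proof
  assume "poly (R n) (\<tau>\<^sup>2) = 0"
  then obtain T where T: "R n = M * T" by (auto simp: poly_eq_0_iff_dvd dvd_def)
  note Rn = monic_opsD[OF R n]
  have "T \<noteq> 0" using Rn(4) T by auto
  then have dT: "n = Suc (degree T)" using degree_linear_times[of T "\<tau>\<^sup>2"] T Rn(1) by simp
  define m where "m = degree T"
  have lT: "coeff T m = 1"
    using lead_coeff_linear_times[of "\<tau>\<^sup>2" T] Rn(1,2) T by (simp add: m_def)
  \<comment> \<open>With m = n - 1 the odd index 2m + 1 = 2n - 1 still lies in
    \<open>I\<close>.\<close>
  have m: "Suc (2 * m) \<in> I" using n dT odd_mem_I Suc_mem_J by (simp add: m_def)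
  note Pm = monic_opsD[OF P m]
  obtain c d where cd: "P (Suc (2 * m)) = at_square c + L * at_square d"
    by (rule even_odd_decomposition)
  have "degree d \<le> m" using degree_odd_part_le[of c \<tau> d m, folded cd] Pm(1) by simp
  \<comment> \<open>Pairing with P_{2m+1} suffices: (x - \<tau>) T(x^2) sees only the odd part d,
    through v(M T d) = v(R_n d), and deg d \<le> m < n. As it is monic of degree 2m + 1, the same
    pairing equals the norm of P_{2m+1}.\<close>
  then have "v (R n * d) = 0"
    using n dT by (intro monic_ops_orthogonal_lower_degree[OF functional_v R index_down(2)])
      (auto simp: m_def)
  then have "u (L * at_square T * P (Suc (2 * m))) = 0"
    unfolding cd pairing_odd T .
  then have "u (P (Suc (2 * m)) * (L * at_square T)) = 0"
    by (simp only: mult.commute)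
  moreover have "at_square T \<noteq> 0"
    using \<open>T \<noteq> 0\<close> by (metis lead_coeff_at_square leading_coeff_0_iff)
  then have "degree (L * at_square T) = Suc (2 * m)"
    by (simp only: degree_linear_times degree_at_square m_def simp_thms not_False_eq_True)
  moreover from this have "coeff (L * at_square T) (Suc (2 * m)) = 1"
    using lead_coeff_linear_times[of \<tau> "at_square T"] lT by (simp add: m_def)
  ultimately show False
    using monic_ops_pairing[OF functional_u P index_down(1) m, where q = "L * at_square T"] Pm(3)
    by (simp del: mult_pCons_left)
qed

end

section \<open>Equivalence of the two orthogonality conditions and the form of P\<close>

lemma ex_monic_ops_iff:
  "(\<exists>R. monic_ops J v R \<and> (\<forall>n\<in>J. poly (R n) (\<tau>\<^sup>2) \<noteq> 0)) \<longleftrightarrow> (\<exists>P. monic_ops I u P)"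
  using monic_ops_interlaced monic_ops_even_part monic_ops_nonzero_at_square by blast

lemma monic_ops_eq_interlaced:
  assumes R: "monic_ops J v R" "\<forall>n\<in>J. poly (R n) (\<tau>\<^sup>2) \<noteq> 0" and P: "monic_ops I u P"
  shows "n \<in> J \<Longrightarrow> P (2 * n) = at_square (R n)"
    and "n \<in> K \<Longrightarrow> P (2 * n + 1) = L * at_square (ker_poly R n)"
proof -
  have eq: "P k = interlaced R k" if "k \<in> I" for k
    using monic_ops_unique[OF functional_u P monic_ops_interlaced[OF R] index_down(1) that] .
  show "P (2 * n) = at_square (R n)" if "n \<in> J"
    using eq[of "2 * n"] that by (simp only: even_mem_I interlaced_even[OF R])
  show "P (2 * n + 1) = L * at_square (ker_poly R n)" if "n \<in> K"
    using eq[of "Suc (2 * n)"] that interlaced_odd[OF R, of n] odd_mem_I[of n]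
    by (simp only: Suc_eq_plus1)
qed

text \<open>The top even index has half N + 1, which lies beyond \<open>K\<close>; this gives the
  extra formula of the finite case.\<close>

lemma Suc_mem_J_of_finite:
  assumes "I = {0..2 * N + 2}"
  shows "N + 1 \<in> J"
  using assms even_mem_I[of "N + 1"] by simp

end

section \<open>Assembly of the equivalences, uniqueness and explicit formulas\<close>

theorem theorem8p6:
  fixes h :: complex and U :: "complex set" and X :: "complex \<Rightarrow> complex"
    and u :: "complex poly \<Rightarrow> complex"
  assumes "h \<noteq> 0"
    and "half_step_invariant h U"
    and "\<forall>s\<in>U. X s = exp (of_real pi * \<i> * s / h)"
    and "admissible h U X"
    and "functional u"
    and "u 1 \<noteq> 0"
  shows
    "((\<exists>\<phi> \<psi>. degree \<phi> \<le> 2 \<and> degree \<psi> = 1 \<and>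
          dual_D h U X (mult_fun \<phi> u) = dual_S h U X (mult_fun \<psi> u))
        \<longleftrightarrow> (\<exists>\<tau>. \<forall>r. u ([:- \<tau>, 1:] * at_square r) = 0))
     \<and> ((\<exists>\<tau>. \<forall>r. u ([:- \<tau>, 1:] * at_square r) = 0)
        \<longleftrightarrow> (\<exists>\<tau> v. functional v \<and> u = dual_J \<tau> v))
     \<and> ((\<exists>\<tau> v. functional v \<and> u = dual_J \<tau> v) \<longrightarrow>
          (\<exists>!\<tau>. \<forall>r. u ([:- \<tau>, 1:] * at_square r) = 0) \<and>
          (\<exists>!(\<tau>, v). functional v \<and> u = dual_J \<tau> v) \<and>
          (\<forall>\<tau>. (\<forall>r. u ([:- \<tau>, 1:] * at_square r) = 0) \<longrightarrow> \<tau> = u [:0, 1:] / u 1) \<and>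
          (\<forall>\<tau> v. functional v \<and> u = dual_J \<tau> v \<longrightarrow> \<tau> = u [:0, 1:] / u 1 \<and> v = sigma u))
     \<and> (\<forall>\<tau> v I J K.
          functional v \<and> u = dual_J \<tau> v \<and>
          ((I = UNIV \<and> J = UNIV \<and> K = UNIV) \<or>
           (\<exists>N. I = {0..2 * N + 2} \<and> J = {0..N + 1} \<and> K = {0..N})) \<longrightarrow>
          ((\<exists>R. monic_ops J v R \<and> (\<forall>n\<in>J. poly (R n) (\<tau>\<^sup>2) \<noteq> 0))
             \<longleftrightarrow> (\<exists>P. monic_ops I u P)) \<and>
          (\<forall>R. monic_ops J v R \<and> (\<forall>n\<in>J. poly (R n) (\<tau>\<^sup>2) \<noteq> 0) \<longrightarrow>
             (\<exists>S. monic_ops K (mult_fun [:- \<tau>\<^sup>2, 1:] v) S \<and>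
                (\<forall>n\<in>K.
                   [:- \<tau>\<^sup>2, 1:] dvd
                     R (n + 1) - smult (poly (R (n + 1)) (\<tau>\<^sup>2) / poly (R n) (\<tau>\<^sup>2)) (R n) \<and>
                   S n = (R (n + 1) - smult (poly (R (n + 1)) (\<tau>\<^sup>2) / poly (R n) (\<tau>\<^sup>2)) (R n))
                           div [:- \<tau>\<^sup>2, 1:]) \<and>
                (\<forall>P. monic_ops I u P \<longrightarrow>
                   (\<forall>n\<in>K. P (2 * n) = at_square (R n) \<and>
                           P (2 * n + 1) = [:- \<tau>, 1:] * at_square (S n)) \<and>
                   (\<forall>N. I = {0..2 * N + 2} \<longrightarrow> P (2 * N + 2) = at_square (R (N + 1)))))))"
proof (intro conjI)
  note exp = assms(1-3)
  have inf: "infinite (X ` U)" using assms(4) by (simp add: admissible_def)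
  note u = \<open>functional u\<close>
  let ?ii = "\<lambda>\<tau>. \<forall>r. u ([:- \<tau>, 1:] * at_square r) = 0"
  let ?iii = "\<lambda>\<tau> v. functional v \<and> u = dual_J \<tau> v"
  \<comment> \<open>The only candidate for v is \<open>sigma u\<close>; with it (ii) and (iii) agree
    for each single \<tau>, so uniqueness transfers between them.\<close>
  have ii_iii: "?ii \<tau> \<longleftrightarrow> ?iii \<tau> (sigma u)" for \<tau>
    using dual_J_sigma[OF u] functional_sigma[OF u] dual_J_vanishes by metis
  have sigma: "v = sigma u" if "?iii \<tau> v" for \<tau> v
    using that sigma_dual_J by metis
  have tau: "\<tau> = u [:0, 1:] / u 1" if "?ii \<tau>" for \<tau>
    using vanishing_parameter[OF u \<open>u 1 \<noteq> 0\<close> that] .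
  show "(\<exists>\<phi> \<psi>. degree \<phi> \<le> 2 \<and> degree \<psi> = 1 \<and>
      dual_D h U X (mult_fun \<phi> u) = dual_S h U X (mult_fun \<psi> u)) \<longleftrightarrow> (\<exists>\<tau>. ?ii \<tau>)"
    unfolding pearson_equation_exp_iff[OF exp inf u]
  proof
    assume "\<exists>\<phi> \<psi>. degree \<phi> \<le> 2 \<and> degree \<psi> = 1 \<and>
      (\<forall>r. u (\<phi> * at_square r) = 0 \<and> u (\<psi> * at_square r) = 0)"
    then obtain \<psi> where \<psi>: "degree \<psi> = 1" "\<And>r. u (\<psi> * at_square r) = 0" by blast
    obtain a b where ab: "\<psi> = [:a, b:]" "b \<noteq> 0" using \<psi>(1) 
    by (cases \<psi>) (auto elim!: degree_eq_zeroE split: if_splits)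
    \<comment> \<open>The root of \<open>\<psi>\<close>, which exists because deg \<psi> =
      1.\<close>
    define \<tau> where "\<tau> = - a / b"
    have "\<psi> = smult b [:- \<tau>, 1:]" using ab by (simp add: \<tau>_def)
    then have "b * u ([:- \<tau>, 1:] * at_square r) = 0" for r
      using \<psi>(2)[of r] functional_smult[OF u] by (metis mult_smult_left)
    then show "\<exists>\<tau>. ?ii \<tau>" using ab(2) by auto
  next
    assume "\<exists>\<tau>. ?ii \<tau>"
    then obtain \<tau> where "?ii \<tau>" by blast
    then show "\<exists>\<phi> \<psi>. degree \<phi> \<le> 2 \<and> degree \<psi> = 1 \<and>
      (\<forall>r. u (\<phi> * at_square r) = 0 \<and> u (\<psi> * at_square r) = 0)"
      \<comment> \<open>With \<phi> = 0 and \<psi> = x - \<tau> the condition on \<phi> is trivial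
        and the one on \<psi> is (ii).\<close>
      by (intro exI[of _ 0] exI[of _ "[:- \<tau>, 1:]"]) (simp add: functional_zero[OF u])
  qed
  show "(\<exists>\<tau>. ?ii \<tau>) \<longleftrightarrow> (\<exists>\<tau> v. ?iii \<tau> v)"
    using ii_iii sigma by metis
  show "(\<exists>\<tau> v. ?iii \<tau> v) \<longrightarrow> (\<exists>!\<tau>. ?ii \<tau>) \<and> (\<exists>!(\<tau>, v). ?iii \<tau> v) \<and>
      (\<forall>\<tau>. ?ii \<tau> \<longrightarrow> \<tau> = u [:0, 1:] / u 1) \<and>
      (\<forall>\<tau> v. ?iii \<tau> v \<longrightarrow> \<tau> = u [:0, 1:] / u 1 \<and> v = sigma u)"
  proof
    assume "\<exists>\<tau> v. ?iii \<tau> v"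
    then obtain \<tau> where \<tau>: "?ii \<tau>" using ii_iii sigma by metis
    have tau': "\<tau>' = u [:0, 1:] / u 1" if "?iii \<tau>' v" for \<tau>' v
      using that tau ii_iii sigma by metis
    have "\<exists>!\<tau>. ?ii \<tau>" using \<tau> tau by blast
    moreover have "\<exists>!(\<tau>, v). ?iii \<tau> v"
    proof (rule ex1I[of _ "(\<tau>, sigma u)"])
      show "case (\<tau>, sigma u) of (\<tau>, v) \<Rightarrow> ?iii \<tau> v" using \<tau> ii_iii by auto
      fix y assume "case y of (\<tau>, v) \<Rightarrow> ?iii \<tau> v"
      then obtain \<tau>' v where y: "y = (\<tau>', v)" "?iii \<tau>' v" by (cases y) auto
      show "y = (\<tau>, sigma u)" using tau[OF \<tau>] tau'[OF y(2)] sigma[OF y(2)] y(1) by simp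
    qed
    ultimately show "(\<exists>!\<tau>. ?ii \<tau>) \<and> (\<exists>!(\<tau>, v). ?iii \<tau> v) \<and>
      (\<forall>\<tau>. ?ii \<tau> \<longrightarrow> \<tau> = u [:0, 1:] / u 1) \<and>
      (\<forall>\<tau> v. ?iii \<tau> v \<longrightarrow> \<tau> = u [:0, 1:] / u 1 \<and> v = sigma u)"
      using tau tau' sigma by (intro conjI allI impI) (assumption | metis)+
  qed
next
  show "\<forall>\<tau> v I J K.
          functional v \<and> u = dual_J \<tau> v \<and>
          ((I = UNIV \<and> J = UNIV \<and> K = UNIV) \<or>
           (\<exists>N. I = {0..2 * N + 2} \<and> J = {0..N + 1} \<and> K = {0..N})) \<longrightarrow>
          ((\<exists>R. monic_ops J v R \<and> (\<forall>n\<in>J. poly (R n) (\<tau>\<^sup>2) \<noteq> 0))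
             \<longleftrightarrow> (\<exists>P. monic_ops I u P)) \<and>
          (\<forall>R. monic_ops J v R \<and> (\<forall>n\<in>J. poly (R n) (\<tau>\<^sup>2) \<noteq> 0) \<longrightarrow>
             (\<exists>S. monic_ops K (mult_fun [:- \<tau>\<^sup>2, 1:] v) S \<and>
                (\<forall>n\<in>K.
                   [:- \<tau>\<^sup>2, 1:] dvd
                     R (n + 1) - smult (poly (R (n + 1)) (\<tau>\<^sup>2) / poly (R n) (\<tau>\<^sup>2)) (R n) \<and>
                   S n = (R (n + 1) - smult (poly (R (n + 1)) (\<tau>\<^sup>2) / poly (R n) (\<tau>\<^sup>2)) (R n))
                           div [:- \<tau>\<^sup>2, 1:]) \<and>
                (\<forall>P. monic_ops I u P \<longrightarrow>
                   (\<forall>n\<in>K. P (2 * n) = at_square (R n) \<and>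
                           P (2 * n + 1) = [:- \<tau>, 1:] * at_square (S n)) \<and>
                   (\<forall>N. I = {0..2 * N + 2} \<longrightarrow> P (2 * N + 2) = at_square (R (N + 1))))))"
    (is "\<forall>\<tau> v I J K. ?hyp \<tau> v I J K \<longrightarrow> ?iff \<tau> v I J \<and> (\<forall>R. ?R \<tau> v J R \<longrightarrow> ?S \<tau> v I K R)")
  proof (intro allI impI)
    fix \<tau> v and I J K :: "nat set"
    assume "?hyp \<tau> v I J K"
    then interpret even_part_functional_index u v \<tau> I J K
      using \<open>functional u\<close> by unfold_locales auto
    have "?S \<tau> v I K R" if R: "?R \<tau> v J R" for R
    proof (rule exI[of _ "ker_poly R"], intro conjI ballI allI impI)
      note R' = conjunct1[OF R] conjunct2[OF R]
      show "monic_ops K (mult_fun M v) (ker_poly R)" by (rule monic_ops_ker_poly[OF R'])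
      show "M dvd R (n + 1) - smult (poly (R (n + 1)) (\<tau>\<^sup>2) / poly (R n) (\<tau>\<^sup>2)) (R n)" if "n \<in> K" for n
        using ker_num_dvd[OF R' that] by (simp only: ker_num_def)
      show "ker_poly R n = (R (n + 1) - smult (poly (R (n + 1)) (\<tau>\<^sup>2) / poly (R n) (\<tau>\<^sup>2)) (R n)) div M" for n
        by (simp only: ker_num_def ker_poly_def)
      fix P assume P: "monic_ops I u P"
      note eq = monic_ops_eq_interlaced[OF R' P]
      show "P (2 * n) = at_square (R n)" if "n \<in> K" for n
        using eq(1) that mem_K_imp_mem_J by blast
      show "P (2 * n + 1) = L * at_square (ker_poly R n)" if "n \<in> K" for n
        using eq(2) that by blast
      show "P (2 * N + 2) = at_square (R (N + 1))" if "I = {0..2 * N + 2}" for N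
        using eq(1)[OF Suc_mem_J_of_finite[OF that]] by simp
    qed
    then show "?iff \<tau> v I J \<and> (\<forall>R. ?R \<tau> v J R \<longrightarrow> ?S \<tau> v I K R)"
      using ex_monic_ops_iff by blast
  qed
qed

end
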